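(* Let $X$ be a real Banach space, let $T:X\rightrightarrows X^{\ast}$ be a maximal monotone operator and let $\varphi\in\mathcal{H}(T)$. Define $F,\widetilde F:X\times X\to\overline{\mathbb{R}}$ by $$F(x,y)=\sup_{x^{\ast}\in X^{\ast}}\{\langle x^{\ast},y\rangle-\varphi^{\ast}(x^{\ast},x)\},\qquad \widetilde F(x,y)=-\sup_{y^{\ast}\in X^{\ast}}\{\langle y^{\ast},x\rangle-\varphi(y,y^{\ast})\}.$$ Let $H:X\times X\to\overline{\mathbb{R}}$ be a saddle function. Then $H$ satisfies $$\varphi_{H}=\varphi\quad\text{and}\quad\varphi^{H}=(\varphi^{\ast})^{t}$$ if and only if $F\le H\le\widetilde F$ pointwise on $X\times X$.
   Context: $X$ is a real Banach space, $X^{\ast}$ its topological dual endowed with the weak$^{\ast}$ topology, $\langle x^{\ast},x\rangle$ the duality product. $X\times X^{\ast}$ carries the product (norm $\times$ weak$^{\ast}$) topology, with dual $X^{\ast}\times X$ under $\langle(x^{\ast},x),(y,y^{\ast})\rangle=\langle x^{\ast},y\rangle+\langle y^{\ast},x\rangle$. $\overline{\mathbb{R}}=\mathbb{R}\cup\{-\infty,+\infty\}$. An $\overline{\mathbb{R}}$-valued function is convex if its epigraph $\{(x,\mu):\mu\in\mathbb{R},\ f(x)\le\mu\}$ is convex; $f$ is concave if $-f$ is convex. The closure of a convex function $f$ is the pointwise supremum of all continuous affine functions majorized by $f$ (identically $-\infty$ if there are none); $f$ is closed if it equals its closure. $D(T)=\{x:T(x)\ne\emptyset\}$, $\operatorname{gph}T=\{(x,x^{\ast}):x^{\ast}\in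 T(x)\}$; $D(T)\neq\emptyset$ is assumed. $T$ is monotone if $\langle x^{\ast}-y^{\ast},x-y\rangle\ge0$ whenever $x^{\ast}\in T(x)$, $y^{\ast}\in T(y)$; it is maximal monotone if moreover its graph is not properly contained in the graph of another monotone operator. $\mathcal{H}(T)$, the class of representative functions of $T$, is the set of all closed convex $\varphi:X\times X^{\ast}\to\overline{\mathbb{R}}$ such that $\varphi(x,x^{\ast})\ge\langle x^{\ast},x\rangle$ for all $(x,x^{\ast})$, and $\varphi(x,x^{\ast})=\langle x^{\ast},x\rangle$ whenever $(x,x^{\ast})\in\operatorname{gph}T$. The conjugate of $\varphi$ is $\varphi^{\ast}(x^{\ast},x)=\sup_{(y,y^{\ast})\in X\times X^{\ast}}\big(\langle x^{\ast},y\rangle+\langle y^{\ast},x\rangle-\varphi(y,y^{\ast})\big)$ and $(\varphi^{\ast})^{t}(x,x^{\ast})=\varphi^{\ast}(x^{\ast},x)$. A saddle function is a function $H:X\times X\to\overline{\mathbb{R}}$ which is concave in the first argument and convex in the second. For such $H$, the Fitzpatrick transform is $\varphi_{H}(x,x^{\ast})=\sup_{y\in X}(\langle x^{\ast},y\rangle+H(y,x))$ and the upper Fitzpatrick transform is $\varphi^{H}(x,x^{\ast})=\sup_{y\in X}(\langle x^{\ast},y\rangle-H(x,y))$. *)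

theory Defs
  imports "HOL-Analysis.Analysis"
begin

type_synonym 'a dual = "'a \<Rightarrow>\<^sub>L real"

(* For real-valued operators the library's strong operator topology, i.e. the coarsest one
   making all evaluations continuous, is the weak-star topology. *)
abbreviation weak_star :: "('a::real_normed_vector) dual topology"
  where "weak_star \<equiv> strong_operator_topology"

(* The instance topology of the product type is norm x norm; the one used here is norm x weak-star. *)
definition norm_weak_star :: "('a::real_normed_vector \<times> 'a dual) topology"
  where "norm_weak_star = prod_topology euclidean weak_star"


definition convex_fun :: "('b::real_vector \<Rightarrow> ereal) \<Rightarrow> bool"
  where "convex_fun f \<longleftrightarrow> convex {(x, \<mu>::real). f x \<le> ereal \<mu>}"

definition concave_fun :: "('b::real_vector \<Rightarrow> ereal) \<Rightarrow> bool"
  where "concave_fun f \<longleftrightarrow> convex_fun (\<lambda>x. - f x)"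

definition continuous_affine :: "'b topology \<Rightarrow> ('b::real_vector \<Rightarrow> real) \<Rightarrow> bool"
  where "continuous_affine \<tau> g \<longleftrightarrow>
    (\<exists>l c. linear l \<and> g = (\<lambda>z. l z + c)) \<and> continuous_map \<tau> euclideanreal g"

(* The supremum of the empty family is -\<infinity>. *)
definition closure_fun :: "'b topology \<Rightarrow> ('b::real_vector \<Rightarrow> ereal) \<Rightarrow> 'b \<Rightarrow> ereal"
  where "closure_fun \<tau> f x =
    (SUP g \<in> {g. continuous_affine \<tau> g \<and> (\<forall>z. ereal (g z) \<le> f z)}. ereal (g x))"

definition closed_fun :: "'b topology \<Rightarrow> ('b::real_vector \<Rightarrow> ereal) \<Rightarrow> bool"
  where "closed_fun \<tau> f \<longleftrightarrow> closure_fun \<tau> f = f"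


definition op_domain :: "('a \<Rightarrow> 'b set) \<Rightarrow> 'a set"
  where "op_domain T = {x. T x \<noteq> {}}"

definition gph :: "('a \<Rightarrow> 'b set) \<Rightarrow> ('a \<times> 'b) set"
  where "gph T = {(x, x'). x' \<in> T x}"

definition monotone_operator :: "('a::real_normed_vector \<Rightarrow> 'a dual set) \<Rightarrow> bool"
  where "monotone_operator T \<longleftrightarrow>
    (\<forall>x y. \<forall>x' \<in> T x. \<forall>y' \<in> T y. 0 \<le> blinfun_apply (x' - y') (x - y))"

definition maximal_monotone :: "('a::real_normed_vector \<Rightarrow> 'a dual set) \<Rightarrow> bool"
  where "maximal_monotone T \<longleftrightarrow>
    monotone_operator T \<and> \<not> (\<exists>S. monotone_operator S \<and> gph T \<subset> gph S)"

definition representative_functions ::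
    "('a::real_normed_vector \<Rightarrow> 'a dual set) \<Rightarrow> ('a \<times> 'a dual \<Rightarrow> ereal) set"
  where "representative_functions T =
    {\<phi>. convex_fun \<phi> \<and> closed_fun norm_weak_star \<phi> \<and>
        (\<forall>x x'. ereal (blinfun_apply x' x) \<le> \<phi> (x, x')) \<and>
        (\<forall>(x, x') \<in> gph T. \<phi> (x, x') = ereal (blinfun_apply x' x))}"

definition conjugate_fun ::
    "('a::real_normed_vector \<times> 'a dual \<Rightarrow> ereal) \<Rightarrow> 'a dual \<times> 'a \<Rightarrow> ereal"
  where "conjugate_fun \<phi> = (\<lambda>(x', x).
    SUP (y, y') \<in> UNIV. ereal (blinfun_apply x' y + blinfun_apply y' x) - \<phi> (y, y'))"

definition transpose_fun :: "('b \<times> 'a \<Rightarrow> ereal) \<Rightarrow> 'a \<times> 'b \<Rightarrow> ereal"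
  where "transpose_fun \<psi> = (\<lambda>(x, x'). \<psi> (x', x))"


definition saddle_function :: "('a::real_vector \<times> 'a \<Rightarrow> ereal) \<Rightarrow> bool"
  where "saddle_function H \<longleftrightarrow>
    (\<forall>y. concave_fun (\<lambda>x. H (x, y))) \<and> (\<forall>x. convex_fun (\<lambda>y. H (x, y)))"

definition fitzpatrick_transform ::
    "('a::real_normed_vector \<times> 'a \<Rightarrow> ereal) \<Rightarrow> 'a \<times> 'a dual \<Rightarrow> ereal"
  where "fitzpatrick_transform H = (\<lambda>(x, x'). SUP y. ereal (blinfun_apply x' y) + H (y, x))"

definition upper_fitzpatrick_transform ::
    "('a::real_normed_vector \<times> 'a \<Rightarrow> ereal) \<Rightarrow> 'a \<times> 'a dual \<Rightarrow> ereal"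
  where "upper_fitzpatrick_transform H = (\<lambda>(x, x'). SUP y. ereal (blinfun_apply x' y) - H (x, y))"

end

theory Submission
  imports Defs
begin

text \<open>
  Since \<open>\<phi>\<^sub>H(x, x') = sup\<^sub>y \<langle>x', y\<rangle> + H(y, x)\<close>, the inequality \<open>\<phi>\<^sub>H \<le> \<phi>\<close> says that
  \<open>\<langle>x', y\<rangle> + H(y, x) \<le> \<phi>(x, x')\<close> for all \<open>x, y, x'\<close>. Moving \<open>H\<close> to one side and optimising over
  \<open>x'\<close> turns this into \<open>H \<le> F'\<close>; in the same way \<open>\<phi>\<^sup>H \<le> (\<phi>\<^sup>*)\<^sup>t\<close> amounts to \<open>F \<le> H\<close>. So the
  bounds on \<open>H\<close> are equivalent to these two inequalities between transforms, and it remains to see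
  that the bounds also force the opposite inequalities.

  For \<open>(\<phi>\<^sup>*)\<^sup>t \<le> \<phi>\<^sup>H\<close> this is immediate: \<open>\<phi>\<^sup>*\<close> is a supremum over pairs \<open>(y, y')\<close>, and taking the
  supremum over \<open>y'\<close> first produces \<open>-F'\<close>, which is at most \<open>-H\<close>.

  For \<open>\<phi> \<le> \<phi>\<^sub>H\<close> the closedness of \<open>\<phi>\<close> enters: by \<open>H \<ge> F\<close>, the transform \<open>\<phi>\<^sub>H\<close> dominates the
  biconjugate of \<open>\<phi>\<close>, so this is the Fenchel--Moreau inequality. As \<open>\<phi>\<close> is by definition the
  supremum of its continuous affine minorants, it suffices that \<open>\<phi>\<^sub>H\<close> lies above each of them, and
  that follows by inserting the slope of the minorant into the suprema defining \<open>F\<close> and \<open>\<phi>\<^sub>H\<close>.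
  The slope must then be a pair \<open>(z', y)\<close> in \<open>X\<^sup>* \<times> X\<close>, that is, the dual of \<open>X \<times> X\<^sup>*\<close> under
  norm \<open>\<times>\<close> weak-star has to be \<open>X\<^sup>* \<times> X\<close>. This representation
  (\<open>continuous_affine_norm_weak_star_obtain\<close>) carries the proof; at its core is the fact
  that a weak-star continuous functional vanishes on the annihilator of a finite set, and hence
  is evaluation at a vector.
\<close>

section \<open>Continuous affine functions for the product of the norm and weak-star topologies\<close>

text \<open>
  Induction on \<open>A\<close>. If every functional annihilating \<open>A\<close> vanishes at the new point \<open>a\<close> as well, then
  \<open>A\<close> and \<open>insert a A\<close> have the same annihilator. Otherwise there is \<open>u\<close> annihilating \<open>A\<close> with
  \<open>u a = 1\<close>, and subtracting \<open>l u\<close> times evaluation at \<open>a\<close> from \<open>l\<close> reduces to \<open>A\<close>, because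
  \<open>f - f a *\<^sub>R u\<close> annihilates \<open>insert a A\<close> for every \<open>f\<close> that annihilates \<open>A\<close>.
\<close>
lemma linear_vanishing_on_annihilator_is_evaluation:
  fixes l :: "'a::real_normed_vector dual \<Rightarrow> real"
  assumes "finite A" "linear l"
    and "\<And>f. (\<And>a. a \<in> A \<Longrightarrow> blinfun_apply f a = 0) \<Longrightarrow> l f = 0"
  shows "\<exists>y. \<forall>f. l f = blinfun_apply f y"
  using assms
proof (induction A arbitrary: l rule: finite_induct)
  case empty
  then have "\<forall>f. l f = blinfun_apply f 0" by (simp add: blinfun.zero_right)
  then show ?case by blast
next
  case (insert a A)
  note lin = linear_add[OF insert.prems(1)] linear_diff[OF insert.prems(1)]
    linear_scale[OF insert.prems(1)]
  show ?case
  proof (cases "\<exists>u::'a dual. (\<forall>b\<in>A. blinfun_apply u b = 0) \<and> blinfun_apply u a \<noteq> 0")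
    case True
    then obtain u0 :: "'a dual" where u0: "\<And>b. b \<in> A \<Longrightarrow> blinfun_apply u0 b = 0" "blinfun_apply u0 a \<noteq> 0"
      by blast
    define u where "u = (1 / blinfun_apply u0 a) *\<^sub>R u0"
    have u: "blinfun_apply u b = 0" if "b \<in> A" for b
      using u0 that by (simp add: u_def blinfun.scaleR_left)
    have ua: "blinfun_apply u a = 1"
      using u0 by (simp add: u_def blinfun.scaleR_left)
    let ?m = "\<lambda>f. l f - l u * blinfun_apply f a"
    have "linear ?m"
      by (rule linearI) (simp_all add: lin blinfun.add_left blinfun.scaleR_left algebra_simps)
    moreover have "?m f = 0" if f: "\<And>b. b \<in> A \<Longrightarrow> blinfun_apply f b = 0" for f
    proof -
      have "l (f - blinfun_apply f a *\<^sub>R u) = 0"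
        using f u ua
        by (intro insert.prems(2)) (auto simp: blinfun.diff_left blinfun.scaleR_left)
      then show ?thesis by (simp add: lin)
    qed
    ultimately obtain y where "\<And>f. ?m f = blinfun_apply f y"
      using insert.IH by blast
    then have "l f = blinfun_apply f (y + l u *\<^sub>R a)" for f
      by (simp add: blinfun.add_right blinfun.scaleR_right flip: diff_eq_eq)
    then show ?thesis by blast
  next
    case False
    then show ?thesis
      using insert.prems by (intro insert.IH) auto
  qed
qed

text \<open>
  The preimage of \<open>{-1<..<1}\<close> contains a basic weak-star neighbourhood of \<open>0\<close>, which restricts values
  only on a finite set \<open>A\<close>. The annihilator of \<open>A\<close> is a subspace inside that neighbourhood, so
  \<open>l\<close> is bounded by \<open>1\<close> on it and therefore zero.
\<close>
lemma weak_star_continuous_linear_is_evaluation: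
  fixes l :: "'a::real_normed_vector dual \<Rightarrow> real"
  assumes "linear l" "continuous_map weak_star euclideanreal l"
  obtains y where "\<And>f. l f = blinfun_apply f y"
proof -
  have "openin weak_star {f \<in> topspace weak_star. l f \<in> {-1<..<1}}"
    by (rule openin_continuous_map_preimage[OF assms(2)]) simp
  then obtain U where U: "open U" "{f. l f \<in> {-1<..<1}} = blinfun_apply -` U"
    unfolding strong_operator_topology_def openin_pullback_topology topspace_pullback_topology
    by auto
  have l0: "l 0 = 0" using assms(1) by (rule linear_0)
  have "blinfun_apply 0 \<in> U" using U(2) l0 by auto
  moreover have "openin (product_topology (\<lambda>i::'a. euclideanreal) UNIV) U"
    using U(1) by (simp add: euclidean_product_topology)
  ultimately obtain X where X: "blinfun_apply 0 \<in> Pi\<^sub>E UNIV X"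
      "finite {i. X i \<noteq> UNIV}" "Pi\<^sub>E UNIV X \<subseteq> U"
    using product_topology_open_contains_basis[of "\<lambda>i::'a. euclideanreal" UNIV U "blinfun_apply 0"]
    by auto
  have "l f = 0" if f: "\<And>a. a \<in> {i. X i \<noteq> UNIV} \<Longrightarrow> blinfun_apply f a = 0" for f
  proof (rule ccontr)
    assume nz: "l f \<noteq> 0"
    define g where "g = (1 / l f) *\<^sub>R f"
    have "blinfun_apply g i \<in> X i" for i
    proof (cases "X i = UNIV")
      case False
      then have "blinfun_apply g i = blinfun_apply 0 i"
        using f by (simp add: g_def blinfun.scaleR_left)
      also have "\<dots> \<in> X i" using X(1) by (simp add: PiE_iff)
      finally show ?thesis .
    qed simp
    then have "blinfun_apply g \<in> U" using X(3) by (auto simp: PiE_iff)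
    then have "l g < 1" using U(2) by auto
    moreover have "l g = 1" using nz by (simp add: g_def linear_scale[OF assms(1)])
    ultimately show False by simp
  qed
  then show thesis
    using linear_vanishing_on_annihilator_is_evaluation[OF X(2) assms(1)] that by blast
qed

lemma continuous_linear_imp_bounded_linear:
  fixes l :: "'a::real_normed_vector \<Rightarrow> 'b::real_normed_vector"
  assumes "linear l" "continuous_on UNIV l"
  shows "bounded_linear l"
proof -
  have "isCont l 0" using assms(2) by (simp add: continuous_on_eq_continuous_at)
  then obtain d where d: "d > 0" "\<And>x. norm x < d \<Longrightarrow> norm (l x) < 1"
    using linear_0[OF assms(1)] unfolding continuous_at_eps_delta
    by (metis dist_0_norm dist_commute zero_less_one)
  have "norm (l x) \<le> norm x * (2 / d)" for x
  proof (cases "x = 0")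
    case False
    let ?t = "d / (2 * norm x)"
    have "norm (?t *\<^sub>R x) < d" using False d(1) by simp
    from d(2)[OF this] show ?thesis
      using False d(1) by (simp add: linear_scale[OF assms(1)] field_simps)
  qed (simp add: linear_0[OF assms(1)])
  then show ?thesis
    using assms(1) by (intro bounded_linear_intro[of l "2 / d"]) (auto simp: linear_add linear_scale)
qed

text \<open>A linear functional on a product is the sum of its restrictions to the two axes.\<close>
lemma continuous_affine_norm_weak_star_obtain:
  fixes g :: "'a::real_normed_vector \<times> 'a dual \<Rightarrow> real"
  assumes "continuous_affine norm_weak_star g"
  obtains z' y c where
    "\<And>x x'. g (x, x') = blinfun_apply z' x + blinfun_apply x' y + c"
proof -
  obtain l c where l: "linear l" and g: "g = (\<lambda>z. l z + c)"
    and cont: "continuous_map norm_weak_star euclideanreal g"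
    using assms unfolding continuous_affine_def by blast
  have cl: "continuous_map norm_weak_star euclideanreal l"
  proof -
    have "continuous_map norm_weak_star euclideanreal (\<lambda>z. g z - c)"
      using cont by (intro continuous_map_diff) auto
    then show ?thesis by (simp add: g)
  qed
  have "continuous_map euclidean norm_weak_star (\<lambda>x::'a. (x, 0::'a dual))"
    and "continuous_map weak_star norm_weak_star (\<lambda>x'. (0::'a, x'))"
    by (auto simp: norm_weak_star_def strong_operator_topology_topspace
        intro!: continuous_map_pairedI)
  from this[THEN continuous_map_compose[OF _ cl]]
  have c1: "continuous_on UNIV (\<lambda>x. l (x, 0))"
    and c2: "continuous_map weak_star euclideanreal (\<lambda>x'. l (0, x'))"
    by (simp_all add: o_def)
  have l1: "linear (\<lambda>x. l (x, 0))" and l2: "linear (\<lambda>x'. l (0, x'))"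
    using linear_add[OF l, of "(_, 0)" "(_, 0)"] linear_scale[OF l, of _ "(_, 0)"]
      linear_add[OF l, of "(0, _)" "(0, _)"] linear_scale[OF l, of _ "(0, _)"]
    by (auto intro!: linearI)
  obtain y where y: "\<And>x'. l (0, x') = blinfun_apply x' y"
    using weak_star_continuous_linear_is_evaluation[OF l2 c2] by blast
  have "g (x, x') = blinfun_apply (Blinfun (\<lambda>x. l (x, 0))) x + blinfun_apply x' y + c" for x x'
    using linear_add[OF l, of "(x, 0)" "(0, x')"] y
      bounded_linear_Blinfun_apply[OF continuous_linear_imp_bounded_linear[OF l1 c1]]
    by (simp add: g)
  then show thesis using that by blast
qed

section \<open>Moving a finite term across extended-real inequalities\<close>

text \<open>
  Only the pairing \<open>r\<close> is known to be finite, so every rearrangement keeps \<open>a\<close> and \<open>b\<close> apart: no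
  sum or difference of the two, which could be \<open>\<infinity> - \<infinity>\<close>, is formed.
\<close>
lemma ereal_add_le_iff_diff_le_uminus:
  fixes a b :: ereal
  shows "ereal r + a \<le> b \<longleftrightarrow> ereal r - b \<le> - a"
  by (cases a; cases b) auto

lemma ereal_le_uminus_swap:
  fixes a b :: ereal
  shows "a \<le> - b \<longleftrightarrow> b \<le> - a"
  by (cases a; cases b) auto

lemma ereal_diff_le_iff_diff_le:
  fixes a b :: ereal
  shows "ereal r - a \<le> b \<longleftrightarrow> ereal r - b \<le> a"
  by (cases a; cases b) auto

section \<open>The bounds as inequalities between transforms\<close>

lemma fitzpatrick_transform_le_iff:
  fixes \<phi> :: "'a::real_normed_vector \<times> 'a dual \<Rightarrow> ereal"
  shows "fitzpatrick_transform H \<le> \<phi> \<longleftrightarrow>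
    (\<forall>x y. H (x, y) \<le> - (SUP y' \<in> UNIV. ereal (blinfun_apply y' x) - \<phi> (y, y')))"
proof -
  have "fitzpatrick_transform H \<le> \<phi> \<longleftrightarrow>
      (\<forall>y y' x. ereal (blinfun_apply y' x) + H (x, y) \<le> \<phi> (y, y'))"
    by (auto simp: le_fun_def fitzpatrick_transform_def SUP_le_iff)
  also have "\<dots> \<longleftrightarrow> (\<forall>x y y'. ereal (blinfun_apply y' x) - \<phi> (y, y') \<le> - H (x, y))"
    by (auto simp: ereal_add_le_iff_diff_le_uminus)
  also have "\<dots> \<longleftrightarrow>
      (\<forall>x y. (SUP y' \<in> UNIV. ereal (blinfun_apply y' x) - \<phi> (y, y')) \<le> - H (x, y))"
    by (simp add: SUP_le_iff)
  also have "\<dots> \<longleftrightarrow>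
      (\<forall>x y. H (x, y) \<le> - (SUP y' \<in> UNIV. ereal (blinfun_apply y' x) - \<phi> (y, y')))"
    by (subst ereal_le_uminus_swap) (rule refl)
  finally show ?thesis .
qed

lemma upper_fitzpatrick_transform_le_iff:
  fixes \<psi> :: "'a::real_normed_vector dual \<times> 'a \<Rightarrow> ereal"
  shows "upper_fitzpatrick_transform H \<le> transpose_fun \<psi> \<longleftrightarrow>
    (\<forall>x y. (SUP x' \<in> UNIV. ereal (blinfun_apply x' y) - \<psi> (x', x)) \<le> H (x, y))"
  by (auto simp: le_fun_def upper_fitzpatrick_transform_def transpose_fun_def SUP_le_iff
      ereal_diff_le_iff_diff_le)

section \<open>The opposite inequalities\<close>

text \<open>
  For an affine minorant with slope \<open>(z', y)\<close> and constant \<open>c\<close>, minorisation says precisely that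
  \<open>\<phi>\<^sup>*(z', y) \<le> -c\<close>. Hence \<open>H(y, x) \<ge> \<langle>z', x\<rangle> + c\<close>, and the term for \<open>y\<close> in the supremum
  \<open>\<phi>\<^sub>H(x, x')\<close> is at least the value of the minorant.
\<close>
lemma closed_le_fitzpatrick_transform:
  fixes \<phi> :: "'a::real_normed_vector \<times> 'a dual \<Rightarrow> ereal"
  assumes closed: "closed_fun norm_weak_star \<phi>"
    and H: "\<And>x y. (SUP x' \<in> UNIV. ereal (blinfun_apply x' y) - conjugate_fun \<phi> (x', x)) \<le> H (x, y)"
  shows "\<phi> \<le> fitzpatrick_transform H"
proof (clarsimp simp: le_fun_def)
  fix x :: 'a and x' :: "'a dual"
  have "ereal (g (x, x')) \<le> fitzpatrick_transform H (x, x')"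
    if aff: "continuous_affine norm_weak_star g" and minor: "\<And>z. ereal (g z) \<le> \<phi> z" for g
  proof -
    obtain z' y c where g: "\<And>w w'. g (w, w') = blinfun_apply z' w + blinfun_apply w' y + c"
      using continuous_affine_norm_weak_star_obtain[OF aff] by metis
    have "ereal (blinfun_apply z' w + blinfun_apply w' y) - \<phi> (w, w') \<le> ereal (- c)" for w w'
      using minor[of "(w, w')"] by (cases "\<phi> (w, w')") (auto simp: g)
    then have "conjugate_fun \<phi> (z', y) \<le> ereal (- c)"
      by (auto simp: conjugate_fun_def SUP_le_iff)
    then have "ereal (blinfun_apply z' x + c) \<le> ereal (blinfun_apply z' x) - conjugate_fun \<phi> (z', y)"
      by (cases "conjugate_fun \<phi> (z', y)") auto
    also have "\<dots> \<le> H (y, x)"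
      using H[where x = y and y = x] by (simp add: SUP_le_iff)
    finally have "ereal (blinfun_apply z' x + c) \<le> H (y, x)" .
    then have "ereal (g (x, x')) \<le> ereal (blinfun_apply x' y) + H (y, x)"
      by (cases "H (y, x)") (auto simp: g)
    also have "\<dots> \<le> fitzpatrick_transform H (x, x')"
      by (auto simp: fitzpatrick_transform_def intro: SUP_upper)
    finally show ?thesis .
  qed
  then have "closure_fun norm_weak_star \<phi> (x, x') \<le> fitzpatrick_transform H (x, x')"
    by (auto simp: closure_fun_def intro!: SUP_least)
  then show "\<phi> (x, x') \<le> fitzpatrick_transform H (x, x')"
    using closed by (simp add: closed_fun_def)
qed

lemma conjugate_le_upper_fitzpatrick_transform:
  fixes \<phi> :: "'a::real_normed_vector \<times> 'a dual \<Rightarrow> ereal"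
  assumes "fitzpatrick_transform H \<le> \<phi>"
  shows "transpose_fun (conjugate_fun \<phi>) \<le> upper_fitzpatrick_transform H"
proof -
  have "ereal (blinfun_apply x' y + blinfun_apply y' x) - \<phi> (y, y')
      \<le> upper_fitzpatrick_transform H (x, x')" for x x' y y'
  proof -
    have "ereal (blinfun_apply y' x) + H (x, y) \<le> fitzpatrick_transform H (y, y')"
      by (auto simp: fitzpatrick_transform_def intro: SUP_upper)
    also have "\<dots> \<le> \<phi> (y, y')" using assms by (simp add: le_fun_def)
    finally have "ereal (blinfun_apply x' y + blinfun_apply y' x) - \<phi> (y, y')
        \<le> ereal (blinfun_apply x' y) - H (x, y)"
      by (cases "H (x, y)"; cases "\<phi> (y, y')") auto
    also have "\<dots> \<le> upper_fitzpatrick_transform H (x, x')"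
      by (auto simp: upper_fitzpatrick_transform_def intro: SUP_upper)
    finally show ?thesis .
  qed
  then show ?thesis
    by (auto simp: le_fun_def transpose_fun_def conjugate_fun_def intro!: SUP_least)
qed

section \<open>Saddle functions representing the given function\<close>

theorem proposition9:
  fixes T :: "'a::banach \<Rightarrow> 'a dual set"
    and \<phi> :: "'a \<times> 'a dual \<Rightarrow> ereal"
    and F F' H :: "'a \<times> 'a \<Rightarrow> ereal"
  assumes "op_domain T \<noteq> {}"
    and "maximal_monotone T"
    and "\<phi> \<in> representative_functions T"
    and "\<And>x y. F (x, y) =
      (SUP x' \<in> UNIV. ereal (blinfun_apply x' y) - conjugate_fun \<phi> (x', x))"
    and "\<And>x y. F' (x, y) =
      - (SUP y' \<in> UNIV. ereal (blinfun_apply y' x) - \<phi> (y, y'))"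
    and "saddle_function H"
  shows "fitzpatrick_transform H = \<phi> \<and>
         upper_fitzpatrick_transform H = transpose_fun (conjugate_fun \<phi>)
     \<longleftrightarrow> (\<forall>x y. F (x, y) \<le> H (x, y) \<and> H (x, y) \<le> F' (x, y))"
proof -
  have closed: "closed_fun norm_weak_star \<phi>"
    using assms(3) by (simp add: representative_functions_def)
  have upper: "fitzpatrick_transform H \<le> \<phi> \<longleftrightarrow> (\<forall>x y. H (x, y) \<le> F' (x, y))"
    by (simp add: fitzpatrick_transform_le_iff assms(5))
  have lower: "upper_fitzpatrick_transform H \<le> transpose_fun (conjugate_fun \<phi>)
      \<longleftrightarrow> (\<forall>x y. F (x, y) \<le> H (x, y))"
    by (simp add: upper_fitzpatrick_transform_le_iff assms(4))
  show ?thesis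
  proof (intro iffI)
    assume "fitzpatrick_transform H = \<phi> \<and>
      upper_fitzpatrick_transform H = transpose_fun (conjugate_fun \<phi>)"
    then show "\<forall>x y. F (x, y) \<le> H (x, y) \<and> H (x, y) \<le> F' (x, y)"
      using upper lower by auto
  next
    assume bounds: "\<forall>x y. F (x, y) \<le> H (x, y) \<and> H (x, y) \<le> F' (x, y)"
    have le: "fitzpatrick_transform H \<le> \<phi>"
      and le': "upper_fitzpatrick_transform H \<le> transpose_fun (conjugate_fun \<phi>)"
      using bounds upper lower by auto
    have "\<phi> \<le> fitzpatrick_transform H"
      using closed bounds by (intro closed_le_fitzpatrick_transform) (simp_all flip: assms(4))
    with le le' conjugate_le_upper_fitzpatrick_transform[OF le]
    show "fitzpatrick_transform H = \<phi> \<and>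
        upper_fitzpatrick_transform H = transpose_fun (conjugate_fun \<phi>)"
      by (auto intro: antisym)
  qed
qed

end
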